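(* Let $n\ge 2$, let $L\subset\mathbb R^n$ be a convex body with $0\in\operatorname{int}L$, let $\phi:[0,\infty)\to[0,\infty)$ be nondecreasing, nonconstant, and convex, and assume that $\int_{\mathbb R^n}e^{-\phi(\|x\|_L)}\,dx=1$. Let $\mu$ be the probability measure on $\mathbb R^n$ with $d\mu(x)=e^{-\phi(\|x\|_L)}\,dx$. Let $K,M\subset\mathbb R^n$ be convex bodies with $0\in\operatorname{int}K\cap\operatorname{int}M$. Then \[ \limsup_{t\to\infty}\frac{\ln\mu(tK;M)}{\phi(r(K,L)t)}=-1. \] Moreover, for every $\varepsilon>0$, the set \[ \left\{t>0:\left|\frac{\ln\mu(tK;M)}{\phi(r(K,L)t)}+1\right|\ge\varepsilon\right\} \] has finite Lebesgue measure.
   Context: A convex body is a compact convex subset of $\mathbb R^n$ with nonempty interior. For a convex body $L$ with $0\in\operatorname{int}L$, the gauge is $\|x\|_L=\inf\{\lambda\ge0:x\in\lambda L\}$. For convex bodies $K,L$ containing the origin in their interiors, $r(K,L)=\max\{R>0:RL\subset K\}$. For a Borel measure $\mu$ on $\mathbb R^n$ and Borel sets $K,M\subset\mathbb R^n$, the mixed measure is \[ \mu(K;M)=\liminf_{\varepsilon\to0^+}\frac{\mu(K+\varepsilon M)-\mu(K)}{\varepsilon}, \] where $A+B=\{a+b:a\in A,\ b\in B\}$ and $\alpha A=\{\alpha x:x\in A\}$. Convention: in the finite-measure assertion, the quotient with denominator $\phi(r(K,L)t)$ is considered only for those $t>0$ for which $\phi(r(K,L)t)>0$. *)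

theory Defs
  imports "HOL-Analysis.Analysis"
begin

definition convex_body :: "'a::euclidean_space set \<Rightarrow> bool" where
  "convex_body K \<longleftrightarrow> convex K \<and> compact K \<and> interior K \<noteq> {}"

definition gauge_norm :: "'a::euclidean_space set \<Rightarrow> 'a \<Rightarrow> real" where
  "gauge_norm L x = Inf {c. 0 \<le> c \<and> x \<in> (*\<^sub>R) c ` L}"

definition rel_inradius :: "'a::euclidean_space set \<Rightarrow> 'a set \<Rightarrow> real" where
  "rel_inradius K L = (GREATEST R. 0 < R \<and> (*\<^sub>R) R ` L \<subseteq> K)"

text \<open>Here \<open>+\<close> on sets is the Minkowski sum. The value lies in the extended reals,
  where the lower limit always exists.\<close>

definition mixed_measure :: "'a::euclidean_space measure \<Rightarrow> 'a set \<Rightarrow> 'a set \<Rightarrow> ereal" where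
  "mixed_measure \<mu> K M =
     Liminf (at_right 0) (\<lambda>\<epsilon>::real.
       (enn2ereal (emeasure \<mu> (K + (*\<^sub>R) \<epsilon> ` M)) - enn2ereal (emeasure \<mu> K)) / ereal \<epsilon>)"

text \<open>The logarithm on \<open>[0, \<infinity>]\<close>, with \<open>ln 0 = -\<infinity>\<close> and \<open>ln \<infinity> = \<infinity>\<close>;
  the values at negative arguments are immaterial.\<close>

definition ln_ext :: "ereal \<Rightarrow> ereal" where
  "ln_ext x = (if x \<le> 0 then -\<infinity> else if x = \<infinity> then \<infinity> else ereal (ln (real_of_ereal x)))"

definition radial_measure :: "(real \<Rightarrow> real) \<Rightarrow> 'a::euclidean_space set \<Rightarrow> 'a measure" where
  "radial_measure \<phi> L = density lborel (\<lambda>x. ennreal (exp (- \<phi> (gauge_norm L x))))"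

end

theory Submission imports Defs
begin

text \<open>
  Write \<open>r\<close> for the relative inradius and \<open>f t\<close> for the mixed measure of \<open>t K\<close> and \<open>M\<close>. Since
  \<open>c K \<subseteq> M \<subseteq> C K\<close>, it suffices to measure thin shells \<open>(t + e) K - t K\<close>. Outside \<open>t K \<supseteq> t r L\<close> the
  density is at most \<open>exp (- \<phi> (r t))\<close>, so \<open>f t \<le> A t\<^sup>n\<^sup>-\<^sup>1 exp (- \<phi> (r t))\<close>; as \<open>\<phi>\<close> grows at least
  linearly, this gives the upper estimate for all large \<open>t\<close>.

  Conversely let \<open>p\<close> be a boundary point of \<open>K\<close> on \<open>r L\<close>. The cone where the gauge of \<open>L\<close> is at most
  \<open>r + \<delta>\<close> times the gauge of \<open>K\<close> contains a ball of radius comparable to \<open>\<delta>\<close> about \<open>p / 2\<close>. Restricting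
  the shell to this cone with \<open>\<delta> = r h / (2 t)\<close> yields \<open>f t \<ge> (c / t) h\<^sup>n exp (- \<phi> (r (t + h)))\<close>. Choose
  \<open>h = exp (- d \<phi> (r t))\<close> with small \<open>d\<close>. The times at which \<open>\<phi> (r t)\<close> increases by more than \<open>1\<close>
  within \<open>h\<close> form a set of finite measure: those with \<open>k \<le> \<phi> (r t) < k + 1\<close> lie in an interval of length
  \<open>exp (- d k)\<close>. Elsewhere the lower estimate matches the upper one.
\<close>

subsection \<open>The gauge of a convex body\<close>

context
  fixes L :: "'a::euclidean_space set"
  assumes body: "convex_body L" and zero: "0 \<in> interior L"
begin

lemma zero_in_body: "0 \<in> L"
  using zero interior_subset by blast

lemma scale_body_mono:
  assumes "0 \<le> c" "c \<le> d"
  shows "(*\<^sub>R) c ` L \<subseteq> (*\<^sub>R) d ` L"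
proof (cases "d = 0")
  case False
  show ?thesis
  proof clarify
    fix x assume x: "x \<in> L"
    have "convex L" using body by (simp add: convex_body_def)
    then have "(c / d) *\<^sub>R x + (1 - c / d) *\<^sub>R 0 \<in> L"
      using x zero_in_body assms False by (intro convexD) (auto simp: divide_simps)
    then show "c *\<^sub>R x \<in> (*\<^sub>R) d ` L"
      using False by (intro image_eqI[of _ _ "(c / d) *\<^sub>R x"]) auto
  qed
qed (use assms in auto)

lemma mem_scale_body: "0 < c \<Longrightarrow> x \<in> (*\<^sub>R) c ` L \<longleftrightarrow> x /\<^sub>R c \<in> L"
  by (force simp: image_iff)

lemma gauge_norm_le: "0 \<le> c \<Longrightarrow> x \<in> (*\<^sub>R) c ` L \<Longrightarrow> gauge_norm L x \<le> c"
  unfolding gauge_norm_def by (intro cInf_lower bdd_belowI[of _ 0]) auto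

lemma gauge_norm_linear_bound: "\<exists>C>0. \<forall>x. gauge_norm L x \<le> C * norm x"
proof -
  obtain e where e: "e > 0" "cball 0 e \<subseteq> L"
    using zero by (meson mem_interior_cball)
  have "gauge_norm L x \<le> (1 / e) * norm x" for x
  proof (cases "x = 0")
    case True
    then show ?thesis using gauge_norm_le[of 0 x] zero_in_body by force
  next
    case False
    then have "x /\<^sub>R (norm x / e) \<in> L" using e by (intro subsetD[OF e(2)]) auto
    then have "x \<in> (*\<^sub>R) (norm x / e) ` L" using False e mem_scale_body[of "norm x / e" x] by simp
    then show ?thesis using gauge_norm_le[of "norm x / e" x] e by simp
  qed
  then show ?thesis using e by (intro exI[of _ "1/e"]) auto
qed

text \<open>\<open>Inf\<close> on the reals is informative only for nonempty sets bounded below. A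
  ball inside \<open>L\<close> supplies an admissible scale; the summand \<open>1\<close> keeps that
  scale positive at \<open>x = 0\<close>.\<close>

lemma gauge_index_nonempty: "{c. 0 \<le> c \<and> x \<in> (*\<^sub>R) c ` L} \<noteq> {}"
proof -
  obtain e where e: "e > 0" "cball 0 e \<subseteq> L"
    using zero by (meson mem_interior_cball)
  define c where "c = norm x / e + 1"
  have c: "c > 0" using e by (simp add: c_def add_nonneg_pos)
  have "norm (x /\<^sub>R c) \<le> e" using e c by (simp add: c_def field_simps)
  then have "x /\<^sub>R c \<in> L" using e by auto
  then show ?thesis using c mem_scale_body[of c x] by force
qed

lemma gauge_norm_nonneg: "0 \<le> gauge_norm L x"
  unfolding gauge_norm_def using gauge_index_nonempty[of x] by (intro cInf_greatest) auto

text \<open>Closedness of \<open>L\<close> decides the boundary case: \<open>x /\<^sub>R d\<close>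
  lies in \<open>L\<close> for every \<open>d > c\<close>, and \<open>d\<close> may decrease to
  \<open>c\<close>.\<close>

lemma gauge_norm_le_iff:
  assumes "0 < c"
  shows "gauge_norm L x \<le> c \<longleftrightarrow> x \<in> (*\<^sub>R) c ` L"
proof
  assume le: "gauge_norm L x \<le> c"
  have mem: "x /\<^sub>R d \<in> L" if "d > c" for d
  proof -
    have "Inf {c. 0 \<le> c \<and> x \<in> (*\<^sub>R) c ` L} < d" using le that by (simp add: gauge_norm_def)
    then obtain s where "0 \<le> s" "x \<in> (*\<^sub>R) s ` L" "s < d"
      using cInf_lessD[OF gauge_index_nonempty] by blast
    then show ?thesis using scale_body_mono[of s d] mem_scale_body[of d x] assms that by auto
  qed
  have "closed L" using body by (simp add: convex_body_def compact_imp_closed)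
  moreover have "((\<lambda>d. x /\<^sub>R d) \<longlongrightarrow> x /\<^sub>R c) (at_right c)"
    using assms by (intro tendsto_intros) auto
  moreover have "eventually (\<lambda>d. x /\<^sub>R d \<in> L) (at_right c)"
    using mem eventually_at_right_less[of c] by (auto elim: eventually_mono)
  ultimately have "x /\<^sub>R c \<in> L"
    by (intro Lim_in_closed_set[of L _ "at_right c"]) auto
  then show "x \<in> (*\<^sub>R) c ` L" using assms mem_scale_body by blast
qed (use assms gauge_norm_le in auto)

text \<open>For \<open>c > 0\<close> both sides have the same sublevel sets at positive levels. The
  slack \<open>e\<close> avoids the level \<open>0\<close>, which \<open>gauge_norm_le_iff\<close>
  excludes.\<close>

lemma gauge_norm_scale:
  assumes "0 \<le> c"
  shows "gauge_norm L (c *\<^sub>R x) = c * gauge_norm L x"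
proof (cases "c = 0")
  case True
  have "gauge_norm L 0 \<le> 0" using gauge_norm_le[of 0 0] zero_in_body by force
  then show ?thesis using True gauge_norm_nonneg[of 0] by simp
next
  case False
  then have c: "c > 0" using assms by simp
  have iff: "gauge_norm L (c *\<^sub>R x) \<le> d \<longleftrightarrow> c * gauge_norm L x \<le> d" if "d > 0" for d
  proof -
    have "c * gauge_norm L x \<le> d \<longleftrightarrow> gauge_norm L x \<le> d / c" using c by (simp add: field_simps)
    also have "\<dots> \<longleftrightarrow> x /\<^sub>R (d / c) \<in> L"
      using gauge_norm_le_iff[of "d / c" x] mem_scale_body[of "d / c" x] c that by simp
    also have "x /\<^sub>R (d / c) = (c *\<^sub>R x) /\<^sub>R d" by (simp add: field_simps)
    finally show ?thesis using gauge_norm_le_iff[OF that] mem_scale_body[OF that] by simp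
  qed
  have nn: "0 \<le> c * gauge_norm L x" using c gauge_norm_nonneg by simp
  show ?thesis
  proof (rule antisym)
    show "gauge_norm L (c *\<^sub>R x) \<le> c * gauge_norm L x"
    proof (rule field_le_epsilon)
      fix e :: real assume "e > 0"
      then show "gauge_norm L (c *\<^sub>R x) \<le> c * gauge_norm L x + e"
        using iff[of "c * gauge_norm L x + e"] nn by simp
    qed
    show "c * gauge_norm L x \<le> gauge_norm L (c *\<^sub>R x)"
    proof (rule field_le_epsilon)
      fix e :: real assume "e > 0"
      then show "c * gauge_norm L x \<le> gauge_norm L (c *\<^sub>R x) + e"
        using iff[of "gauge_norm L (c *\<^sub>R x) + e"] gauge_norm_nonneg[of "c *\<^sub>R x"] by simp
    qed
  qed
qed

text \<open>With \<open>a\<close> and \<open>b\<close> slightly above the two gauges,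
  \<open>(x + y) / (a + b)\<close> is the convex combination of \<open>x / a\<close> and
  \<open>y / b\<close> with weights \<open>a / (a + b)\<close> and
  \<open>b / (a + b)\<close>.\<close>

lemma gauge_norm_triangle: "gauge_norm L (x + y) \<le> gauge_norm L x + gauge_norm L y"
proof (rule field_le_epsilon)
  fix e :: real assume "e > 0"
  define a where "a = gauge_norm L x + e / 2"
  define b where "b = gauge_norm L y + e / 2"
  have ab: "a > 0" "b > 0"
    using gauge_norm_nonneg[of x] gauge_norm_nonneg[of y] \<open>e > 0\<close> by (simp_all add: a_def b_def)
  have "x /\<^sub>R a \<in> L" "y /\<^sub>R b \<in> L"
    using gauge_norm_le_iff[of a x] gauge_norm_le_iff[of b y] mem_scale_body ab \<open>e > 0\<close>
    by (simp_all add: a_def b_def)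
  moreover have "convex L" using body by (simp add: convex_body_def)
  ultimately have "(a / (a + b)) *\<^sub>R (x /\<^sub>R a) + (b / (a + b)) *\<^sub>R (y /\<^sub>R b) \<in> L"
    using ab by (intro convexD) (auto simp flip: add_divide_distrib)
  also have "(a / (a + b)) *\<^sub>R (x /\<^sub>R a) + (b / (a + b)) *\<^sub>R (y /\<^sub>R b) = (x + y) /\<^sub>R (a + b)"
    using ab by (simp add: field_simps scaleR_add_right)
  finally have "gauge_norm L (x + y) \<le> a + b"
    using gauge_norm_le_iff[of "a + b"] mem_scale_body ab by simp
  then show "gauge_norm L (x + y) \<le> gauge_norm L x + gauge_norm L y + e"
    by (simp add: a_def b_def)
qed

text \<open>\<open>L\<close> may fail to be symmetric, so the estimate is one-sided; exchanging
  \<open>x\<close> and \<open>y\<close> gives the other half.\<close>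

lemma gauge_norm_lipschitz: "\<exists>C>0. \<forall>x y. gauge_norm L x \<le> gauge_norm L y + C * dist x y"
proof -
  obtain C where C: "C > 0" "\<And>x. gauge_norm L x \<le> C * norm x"
    using gauge_norm_linear_bound by blast
  have "gauge_norm L x \<le> gauge_norm L y + C * dist x y" for x y
    using gauge_norm_triangle[of y "x - y"] C(2)[of "x - y"] by (simp add: dist_norm)
  then show ?thesis using C(1) by blast
qed

lemma continuous_on_gauge_norm: "continuous_on S (gauge_norm L)"
proof -
  obtain C where C: "C > 0" "\<And>x y. gauge_norm L x \<le> gauge_norm L y + C * dist x y"
    using gauge_norm_lipschitz by blast
  have "C-lipschitz_on S (gauge_norm L)"
  proof (rule lipschitz_onI)
    fix x y show "dist (gauge_norm L x) (gauge_norm L y) \<le> C * dist x y"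
      using C(2)[of x y] C(2)[of y x] by (simp add: dist_real_def dist_commute abs_le_iff)
  qed (use C in auto)
  then show ?thesis by (rule lipschitz_on_continuous_on)
qed

lemma borel_measurable_gauge_norm [measurable]: "gauge_norm L \<in> borel_measurable borel"
  by (intro borel_measurable_continuous_onI continuous_on_gauge_norm)

lemma bounded_imp_subset_scale_body:
  assumes "bounded S"
  shows "\<exists>C>0. S \<subseteq> (*\<^sub>R) C ` L"
proof -
  obtain C where C: "C > 0" "\<And>x. gauge_norm L x \<le> C * norm x"
    using gauge_norm_linear_bound by blast
  obtain B where B: "B > 0" "\<And>x. x \<in> S \<Longrightarrow> norm x \<le> B"
    using assms bounded_pos by blast
  have "gauge_norm L x \<le> C * B" if "x \<in> S" for x
    using C(2)[of x] B(2)[OF that] C(1) by (meson less_imp_le mult_left_mono order_trans)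
  then show ?thesis using gauge_norm_le_iff[of "C * B"] B C by (intro exI[of _ "C * B"]) auto
qed

end

section \<open>Contact point of the largest inscribed dilate\<close>

text \<open>The gauge of \<open>K\<close> attains a maximum \<open>m\<close> on \<open>L\<close> at
  some \<open>q\<close>, and for \<open>R > 0\<close> the dilate \<open>R L\<close> lies in
  \<open>K\<close> exactly when \<open>R * m \<le> 1\<close>. So the greatest ratio exists and is
  \<open>1 / m\<close>, and \<open>p = q / m\<close> is a contact point.\<close>

lemma rel_inradius_contact:
  assumes K: "convex_body K" "0 \<in> interior K" and L: "convex_body L" "0 \<in> interior L"
  obtains p where "0 < rel_inradius K L" "(*\<^sub>R) (rel_inradius K L) ` L \<subseteq> K"
    "gauge_norm K p = 1" "gauge_norm L p \<le> rel_inradius K L"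
proof -
  have "compact L" using L by (simp add: convex_body_def)
  then obtain q where q: "q \<in> L" "\<And>x. x \<in> L \<Longrightarrow> gauge_norm K x \<le> gauge_norm K q"
    using continuous_attains_sup[of L "gauge_norm K"] continuous_on_gauge_norm[OF K] zero_in_body[OF L]
    by blast
  define m where "m = gauge_norm K q"
  have sub: "(*\<^sub>R) R ` L \<subseteq> K \<longleftrightarrow> R * m \<le> 1" if "R > 0" for R
  proof -
    have "(*\<^sub>R) R ` L \<subseteq> K \<longleftrightarrow> (\<forall>x\<in>L. gauge_norm K (R *\<^sub>R x) \<le> 1)"
      using gauge_norm_le_iff[OF K, of 1] by auto
    also have "\<dots> \<longleftrightarrow> R * m \<le> 1"
      using q gauge_norm_scale[OF K, of R] that unfolding m_def
      by (auto intro: order_trans[OF mult_left_mono[of _ "gauge_norm K q" R]])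
    finally show ?thesis .
  qed
  \<comment> \<open>Were \<open>m = 0\<close>, every positive dilate of \<open>L\<close> would lie
    in the bounded set \<open>K\<close>.\<close>
  have "m > 0"
  proof (rule ccontr)
    assume "\<not> m > 0"
    then have m0: "m = 0" using gauge_norm_nonneg[OF K, of q] by (simp add: m_def)
    obtain e where e: "e > 0" "cball 0 e \<subseteq> L" using L by (meson mem_interior_cball)
    obtain b :: 'a where b: "b \<in> Basis" using nonempty_Basis by blast
    have "bounded K" using K by (simp add: convex_body_def compact_imp_bounded)
    then obtain B where B: "B > 0" "\<And>x. x \<in> K \<Longrightarrow> norm x \<le> B" using bounded_pos by blast
    have "e *\<^sub>R b \<in> L" using e b by (intro subsetD[OF e(2)]) simp
    then have "((B + 1) / e) *\<^sub>R (e *\<^sub>R b) \<in> K"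
      using sub[of "(B + 1) / e"] m0 B e by (auto simp: image_subset_iff)
    then show False using B b e B(2)[of "(B + 1) *\<^sub>R b"] by simp
  qed
  have r: "rel_inradius K L = 1 / m" unfolding rel_inradius_def
    using sub \<open>m > 0\<close> by (intro Greatest_equality) (auto simp: field_simps)
  have "gauge_norm L q \<le> 1" using gauge_norm_le_iff[OF L, of 1 q] q by auto
  then show ?thesis using that[of "(1 / m) *\<^sub>R q"] r \<open>m > 0\<close> sub[of "1 / m"]
    gauge_norm_scale[OF K, of "1 / m" q] gauge_norm_scale[OF L, of "1 / m" q]
    by (simp add: m_def divide_simps)
qed

section \<open>Volumes of shells and dilates around Minkowski sums\<close>

lemma measure_lborel_scaleR_image:
  fixes S :: "'a::euclidean_space set"
  assumes "S \<in> sets borel" "0 < s"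
  shows "(*\<^sub>R) s ` S \<in> sets borel" "measure lborel ((*\<^sub>R) s ` S) = s ^ DIM('a) * measure lborel S"
proof -
  have "(*\<^sub>R) s ` S = (\<lambda>x. x /\<^sub>R s) -` S \<inter> space borel"
    using assms by (force simp: image_iff)
  then show *: "(*\<^sub>R) s ` S \<in> sets borel"
    using measurable_sets[of "\<lambda>x::'a. x /\<^sub>R s" borel borel S] assms by simp
  show "measure lborel ((*\<^sub>R) s ` S) = s ^ DIM('a) * measure lborel S"
    using measure_lebesgue_affine[of s 0 S] assms(2) * assms(1) by simp
qed

lemma compact_borel_lborel_finite:
  fixes S :: "'a::euclidean_space set"
  assumes "compact S"
  shows "S \<in> sets borel" "emeasure lborel S < \<infinity>"
  using assms borel_compact emeasure_compact_finite by auto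

text \<open>Nested dilates are assumed instead of convexity, so that the formula also serves sectors
  of \<open>K\<close>, which may fail to be convex.\<close>

lemma measure_lborel_scaled_shell:
  fixes S :: "'a::euclidean_space set"
  assumes S: "compact S" and "0 < t" "t \<le> s" "(*\<^sub>R) t ` S \<subseteq> (*\<^sub>R) s ` S"
  shows "measure lborel ((*\<^sub>R) s ` S - (*\<^sub>R) t ` S) = (s ^ DIM('a) - t ^ DIM('a)) * measure lborel S"
proof -
  have fm: "(*\<^sub>R) u ` S \<in> fmeasurable lborel" for u
    using compact_borel_lborel_finite[OF compact_scaling[OF S]] by (auto intro: fmeasurableI)
  have S': "S \<in> sets borel" using S by (rule borel_compact)
  have "measure lborel ((*\<^sub>R) s ` S - (*\<^sub>R) t ` S) = measure lborel ((*\<^sub>R) s ` S) - measure lborel ((*\<^sub>R) t ` S)"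
    using fm[of s] fm[of t] assms by (intro measurable_measure_Diff) auto
  then show ?thesis
    using measure_lborel_scaleR_image(2)[OF S', of s] measure_lborel_scaleR_image(2)[OF S', of t] assms
    by (simp add: left_diff_distrib)
qed

text \<open>Subadditivity of the gauge of \<open>K\<close>. Together with
  \<open>scale_subset_minkowski_sum\<close> it traps the sum between two dilates of
  \<open>K\<close>, so that \<open>M\<close> affects only constants.\<close>

lemma minkowski_sum_subset_scale:
  assumes K: "convex_body K" "0 \<in> interior K" and "M \<subseteq> (*\<^sub>R) C ` K" "0 < C" "0 < t" "0 < e"
  shows "(*\<^sub>R) t ` K + (*\<^sub>R) e ` M \<subseteq> (*\<^sub>R) (t + e * C) ` K"
proof (rule subsetI)
  fix x assume "x \<in> (*\<^sub>R) t ` K + (*\<^sub>R) e ` M"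
  then obtain k m where x: "k \<in> K" "m \<in> M" "x = t *\<^sub>R k + e *\<^sub>R m"
    by (auto simp: set_plus_def)
  have "gauge_norm K (t *\<^sub>R k) \<le> t" using gauge_norm_le[OF K, of t] x assms by auto
  moreover have "gauge_norm K m \<le> C" using gauge_norm_le[OF K, of C m] x assms by auto
  then have "gauge_norm K (e *\<^sub>R m) \<le> e * C" using gauge_norm_scale[OF K, of e m] assms by simp
  ultimately have "gauge_norm K x \<le> t + e * C"
    using gauge_norm_triangle[OF K, of "t *\<^sub>R k" "e *\<^sub>R m"] x by simp
  then show "x \<in> (*\<^sub>R) (t + e * C) ` K"
    using gauge_norm_le_iff[OF K, of "t + e * C"] assms by (simp add: add_pos_pos)
qed

lemma scale_subset_minkowski_sum:
  assumes "K \<subseteq> (*\<^sub>R) D ` M" "0 < D"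
  shows "(*\<^sub>R) (t + e / D) ` K \<subseteq> (*\<^sub>R) t ` K + (*\<^sub>R) e ` (M :: 'a::real_vector set)"
proof clarify
  fix k assume k: "k \<in> K"
  then obtain m where m: "m \<in> M" "k = D *\<^sub>R m" using assms by blast
  have "(t + e / D) *\<^sub>R k = t *\<^sub>R k + e *\<^sub>R m"
    using m assms by (simp add: algebra_simps)
  then show "(t + e / D) *\<^sub>R k \<in> (*\<^sub>R) t ` K + (*\<^sub>R) e ` M"
    using k m(1) by auto
qed

lemma compact_minkowski_sum_scaled:
  fixes K M :: "'a::euclidean_space set"
  assumes "convex_body K" "convex_body M"
  shows "compact ((*\<^sub>R) t ` K + (*\<^sub>R) e ` M)"
proof -
  have "compact ((*\<^sub>R) t ` K)" "compact ((*\<^sub>R) e ` M)"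
    using assms by (auto simp: convex_body_def intro: compact_scaling)
  then have "compact {x + y |x y. x \<in> (*\<^sub>R) t ` K \<and> y \<in> (*\<^sub>R) e ` M}" by (rule compact_sums)
  also have "{x + y |x y. x \<in> (*\<^sub>R) t ` K \<and> y \<in> (*\<^sub>R) e ` M} = (*\<^sub>R) t ` K + (*\<^sub>R) e ` M"
    unfolding set_plus_def by blast
  finally show ?thesis .
qed

lemma subset_minkowski_sum_scaled:
  assumes "0 \<in> (M :: 'a::real_vector set)"
  shows "A \<subseteq> A + (*\<^sub>R) e ` M"
proof
  fix x assume "x \<in> A"
  then have "x + e *\<^sub>R 0 \<in> A + (*\<^sub>R) e ` M" using assms by (intro set_plus_intro) auto
  then show "x \<in> A + (*\<^sub>R) e ` M" by simp
qed

subsection \<open>Measurability of the mixed measure under dilation\<close>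

lemma mixed_measure_eq_Liminf_measure:
  assumes "finite_measure \<mu>"
  shows "mixed_measure \<mu> K M =
    Liminf (at_right 0) (\<lambda>e. ereal ((measure \<mu> (K + (*\<^sub>R) e ` M) - measure \<mu> K) / e))"
proof -
  interpret finite_measure \<mu> by fact
  show ?thesis unfolding mixed_measure_def
    by (intro Liminf_eq eventually_mono[OF eventually_at_right_less[of 0]])
      (simp add: emeasure_eq_measure)
qed

text \<open>Monotonicity of \<open>F\<close> replaces continuity: a rational \<open>q\<close> slightly below \<open>e\<close>
  satisfies \<open>(F e - a) / e \<ge> (q / e) * ((F q - a) / q)\<close> with \<open>q / e\<close> close to \<open>1\<close>.\<close>

lemma INF_mono_quotient_rational:
  fixes F :: "real \<Rightarrow> real"
  assumes mono: "\<And>x y. 0 < x \<Longrightarrow> x \<le> y \<Longrightarrow> F x \<le> F y" and ge: "\<And>x. 0 < x \<Longrightarrow> a \<le> F x"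
  shows "(INF e\<in>{0<..<d}. ereal ((F e - a) / e)) = (INF q\<in>{0<..<d} \<inter> \<rat>. ereal ((F q - a) / q))"
proof (rule antisym)
  show "(INF e\<in>{0<..<d}. ereal ((F e - a) / e)) \<le> (INF q\<in>{0<..<d} \<inter> \<rat>. ereal ((F q - a) / q))"
    by (intro INF_superset_mono) auto
  show "(INF q\<in>{0<..<d} \<inter> \<rat>. ereal ((F q - a) / q)) \<le> (INF e\<in>{0<..<d}. ereal ((F e - a) / e))"
  proof (rule INF_greatest)
    fix e assume e: "e \<in> {0<..<d}"
    let ?I = "INF q\<in>{0<..<d} \<inter> \<rat>. ereal ((F q - a) / q)"
    show "?I \<le> ereal ((F e - a) / e)"
    proof (rule ccontr)
      assume "\<not> ?I \<le> ereal ((F e - a) / e)"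
      then obtain z where z: "ereal ((F e - a) / e) < ereal z" "ereal z < ?I"
        using ereal_dense2 by (meson not_le)
      have lt: "F e - a < z * e" using z(1) e by (simp add: field_simps)
      have "0 \<le> F e - a" using ge[of e] e by simp
      then have zpos: "z > 0" using lt e zero_less_mult_pos2[of z e] by simp
      have "(F e - a) / z < e" using lt zpos by (simp add: field_simps)
      then obtain q where q: "q \<in> \<rat>" "(F e - a) / z < q" "q < e" using Rats_dense_in_real by blast
      have "0 \<le> (F e - a) / z" using \<open>0 \<le> F e - a\<close> zpos by simp
      then have "0 < q" using q by linarith
      then have "?I \<le> ereal ((F q - a) / q)" using q e by (intro INF_lower) auto
      from less_le_trans[OF z(2) this] have "z < (F q - a) / q" by simp
      then have "z * q < F q - a" using \<open>0 < q\<close> by (simp add: field_simps)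
      also have "\<dots> \<le> F e - a" using mono[of q e] q \<open>0 < q\<close> by simp
      finally show False using q zpos by (simp add: field_simps)
    qed
  qed
qed

text \<open>The intervals \<open>(0, 1 / (k + 1))\<close> form a countable base of right
  neighbourhoods of \<open>0\<close>; countability lets measurability pass through the
  supremum.\<close>

lemma Liminf_at_right_eq_SUP_INF:
  fixes f :: "real \<Rightarrow> ereal"
  shows "Liminf (at_right 0) f = (SUP k::nat. INF e\<in>{0<..<1 / Suc k}. f e)"
proof (rule antisym)
  show "Liminf (at_right 0) f \<le> (SUP k::nat. INF e\<in>{0<..<1 / Suc k}. f e)"
    unfolding Liminf_def
  proof (rule SUP_least)
    fix P assume "P \<in> {P. eventually P (at_right (0::real))}"
    then obtain b where b: "b > 0" "\<And>y. y > 0 \<Longrightarrow> y < b \<Longrightarrow> P y"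
      by (auto simp: eventually_at_right_field)
    obtain k where "1 / Suc k < b" using nat_approx_posE[OF b(1)] by auto
    then have "(INF x\<in>Collect P. f x) \<le> (INF e\<in>{0<..<1 / Suc k}. f e)"
      using b by (intro INF_superset_mono) auto
    then show "(INF x\<in>Collect P. f x) \<le> (SUP k::nat. INF e\<in>{0<..<1 / Suc k}. f e)"
      by (rule order_trans) (rule SUP_upper, simp)
  qed
  show "(SUP k::nat. INF e\<in>{0<..<1 / Suc k}. f e) \<le> Liminf (at_right 0) f"
  proof (rule SUP_least)
    fix k :: nat
    have "eventually (\<lambda>e. (INF e\<in>{0<..<1 / Suc k}. f e) \<le> f e) (at_right 0)"
      unfolding eventually_at_right_field
      by (intro exI[of _ "1 / Suc k"]) (auto intro: INF_lower)
    then show "(INF e\<in>{0<..<1 / Suc k}. f e) \<le> Liminf (at_right 0) f" by (rule Liminf_bounded)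
  qed
qed

text \<open>For fixed rational \<open>q\<close> both measures in the quotient increase with
  \<open>t > 0\<close> and are therefore Borel in \<open>t\<close>. The lower limit is a countable
  supremum of countable infima of such quotients.\<close>

lemma borel_measurable_mixed_measure_scale:
  fixes K M :: "'a::euclidean_space set"
  assumes fin: "finite_measure \<mu>" and sets: "sets \<mu> = sets borel"
    and K: "convex_body K" "0 \<in> interior K" and M: "convex_body M" "0 \<in> interior M"
  shows "(\<lambda>t. mixed_measure \<mu> ((*\<^sub>R) t ` K) M) \<in> borel_measurable (restrict_space borel {0<..})"
proof -
  interpret finite_measure \<mu> by fact
  have meas: "(*\<^sub>R) t ` K + (*\<^sub>R) e ` M \<in> sets \<mu>" "(*\<^sub>R) t ` K \<in> sets \<mu>" for t e
    using compact_minkowski_sum_scaled[OF K(1) M(1)] K sets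
    by (auto simp: convex_body_def intro!: borel_compact compact_scaling)
  have mono_e: "measure \<mu> ((*\<^sub>R) t ` K + (*\<^sub>R) x ` M) \<le> measure \<mu> ((*\<^sub>R) t ` K + (*\<^sub>R) y ` M)"
    if "0 < x" "x \<le> y" for t x y
    using scale_body_mono[OF M, of x y] that by (intro finite_measure_mono set_plus_mono2 meas) auto
  have ge: "measure \<mu> ((*\<^sub>R) t ` K) \<le> measure \<mu> ((*\<^sub>R) t ` K + (*\<^sub>R) x ` M)" for t x
    by (intro finite_measure_mono subset_minkowski_sum_scaled zero_in_body[OF M] meas)
  have eq: "mixed_measure \<mu> ((*\<^sub>R) t ` K) M = (SUP k::nat. INF q\<in>{0<..<1 / Suc k} \<inter> \<rat>.
      ereal ((measure \<mu> ((*\<^sub>R) t ` K + (*\<^sub>R) q ` M) - measure \<mu> ((*\<^sub>R) t ` K)) / q))" for t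
    unfolding mixed_measure_eq_Liminf_measure[OF fin] Liminf_at_right_eq_SUP_INF
    by (intro SUP_cong refl INF_mono_quotient_rational mono_e ge)
  have [measurable]: "(\<lambda>t. measure \<mu> ((*\<^sub>R) t ` K + (*\<^sub>R) q ` M)) \<in> borel_measurable (restrict_space borel {0<..})" for q
    using scale_body_mono[OF K]
    by (intro borel_measurable_mono_on_fnc mono_onI finite_measure_mono set_plus_mono2 meas) auto
  have [measurable]: "(\<lambda>t. measure \<mu> ((*\<^sub>R) t ` K)) \<in> borel_measurable (restrict_space borel {0<..})"
    using scale_body_mono[OF K]
    by (intro borel_measurable_mono_on_fnc mono_onI finite_measure_mono meas) auto
  show ?thesis unfolding eq
    by (intro borel_measurable_SUP borel_measurable_INF) (auto intro: countable_rat)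
qed

subsection \<open>Growth of the radial profile\<close>

text \<open>With \<open>a k = Inf {s. k + 1 \<le> f s}\<close>, a point \<open>u\<close> where \<open>f\<close> grows by more than \<open>1\<close> within
  distance \<open>exp (- c * f u)\<close> and where \<open>k \<le> f u < k + 1\<close> lies in \<open>[a k - exp (- c * k), a k]\<close>.\<close>

lemma slow_growth_outside_finite_measure:
  fixes f :: "real \<Rightarrow> real"
  assumes nonneg: "\<And>s. 0 \<le> s \<Longrightarrow> 0 \<le> f s" and mono: "mono_on {0..} f" and c: "0 < c"
  obtains E where "E \<in> lmeasurable"
    "\<And>u. 0 \<le> u \<Longrightarrow> u \<notin> E \<Longrightarrow> f (u + exp (- c * f u)) \<le> f u + 1"
proof -
  define a where "a k = Inf {s. 0 \<le> s \<and> real k + 1 \<le> f s}" for k :: nat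
  define J where "J k = {a k - exp (- c * k)..a k}" for k :: nat
  define E where "E = (\<Union>k. J k)"
  have "emeasure lebesgue E \<le> (\<Sum>k. emeasure lebesgue (J k))"
    unfolding E_def J_def by (intro emeasure_subadditive_countably) auto
  also have "\<dots> = (\<Sum>k. ennreal (exp (- c) ^ k))"
    unfolding J_def by (simp add: exp_of_nat_mult[symmetric] mult.commute flip: exp_of_nat_mult)
  also have "\<dots> < \<infinity>"
    using c summable_geometric[of "exp (-c)"] by (simp add: suminf_ennreal2 less_top ennreal_suminf_neq_top)
  finally have "emeasure lebesgue E < \<infinity>" .
  moreover have "E \<in> sets lebesgue" unfolding E_def J_def by auto
  ultimately have "E \<in> lmeasurable" by (intro fmeasurableI)
  moreover have "f (u + exp (- c * f u)) \<le> f u + 1" if u: "0 \<le> u" "u \<notin> E" for u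
  proof (rule ccontr)
    assume big: "\<not> f (u + exp (- c * f u)) \<le> f u + 1"
    define k where "k = nat \<lfloor>f u\<rfloor>"
    have k: "real k \<le> f u" "f u < real k + 1" using nonneg[OF u(1)] unfolding k_def by linarith+
    have "exp (- c * f u) \<le> exp (- c * k)" using k c by simp
    \<comment> \<open>At the right end \<open>f\<close> exceeds \<open>f u + 1\<close>, hence
      \<open>k + 1\<close>, so this point belongs to the set whose infimum is
      \<open>a k\<close>.\<close>
    moreover have "a k \<le> u + exp (- c * f u)" unfolding a_def
      using big k u by (intro cInf_lower bdd_belowI[of _ 0]) auto
    moreover have "u \<le> a k" unfolding a_def
    proof (rule cInf_greatest)
      show "{s. 0 \<le> s \<and> real k + 1 \<le> f s} \<noteq> {}"
        using big k u by (auto intro!: exI[of _ "u + exp (- c * f u)"])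
      fix s assume s: "s \<in> {s. 0 \<le> s \<and> real k + 1 \<le> f s}"
      show "u \<le> s"
      proof (rule ccontr)
        assume "\<not> u \<le> s"
        then have "f s \<le> f u" using mono_onD[OF mono, of s u] s u by auto
        then show False using s k by simp
      qed
    qed
    ultimately have "u \<in> E" unfolding E_def J_def by (intro UN_I[of k]) (auto simp del: exp_le_cancel_iff)
    with u show False by simp
  qed
  ultimately show ?thesis using that by blast
qed

text \<open>A nonconstant monotone function has a strictly rising chord from some \<open>x\<close>
  to some \<open>y\<close>. By convexity \<open>f\<close> stays above the line through this chord
  beyond \<open>y\<close>.\<close>

lemma convex_mono_linear_lower_bound:
  fixes f :: "real \<Rightarrow> real"
  assumes mono: "mono_on {0..} f" and nc: "\<not> f constant_on {0..}" and conv: "convex_on {0..} f"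
  obtains a b y where "0 < a" "\<And>s. y \<le> s \<Longrightarrow> a * s - b \<le> f s"
proof -
  obtain x y where xy: "0 \<le> x" "x < y" "f x < f y"
  proof -
    obtain z where z: "z \<ge> 0" "f z \<noteq> f 0" using nc unfolding constant_on_def by auto
    then have "f 0 < f z" "0 < z" using mono_onD[OF mono, of 0 z] by (auto simp: less_le)
    then show ?thesis using that[of 0 z] by simp
  qed
  define a where "a = (f y - f x) / (y - x)"
  have a: "a > 0" using xy by (simp add: a_def)
  have "a * s - (a * x - f x) \<le> f s" if "y + 1 \<le> s" for s
  proof -
    have "(f x - f y) / (x - y) \<le> (f x - f s) / (x - s)"
      using convex_on_slope_le(1)[OF conv, of x s y] xy that by auto
    also have "(f x - f y) / (x - y) = a" unfolding a_def using xy by (simp add: field_simps)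
    finally have "a \<le> (f s - f x) / (s - x)" by (metis minus_diff_eq minus_divide_divide)
    then show ?thesis using xy that by (simp add: field_simps)
  qed
  then show ?thesis using that a by blast
qed

subsection \<open>Two-sided bounds for the mixed measure\<close>

text \<open>At \<open>q = p / 2\<close> the inequality defining the cone has slack at least
  \<open>\<delta> / 2\<close>. Since \<open>r + \<delta> \<le> 2 * r\<close>, moving by a distance
  \<open>s\<close> costs at most \<open>(B + 2 * r * A) * s\<close>, where \<open>A\<close> and
  \<open>B\<close> are Lipschitz constants of the gauges.\<close>

lemma cone_sector_volume_ge:
  fixes K L :: "'a::euclidean_space set"
  assumes K: "convex_body K" "0 \<in> interior K" and L: "convex_body L" "0 \<in> interior L"
    and p: "gauge_norm K p = 1" "gauge_norm L p \<le> r" and r: "0 < r"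
  shows "\<exists>c>0. \<forall>\<delta>. 0 < \<delta> \<and> \<delta> \<le> r \<longrightarrow>
    c * \<delta> ^ DIM('a) \<le> measure lborel (K \<inter> {x. gauge_norm L x \<le> (r + \<delta>) * gauge_norm K x})"
proof -
  obtain A where A: "A > 0" "\<And>x y. gauge_norm K x \<le> gauge_norm K y + A * dist x y"
    using gauge_norm_lipschitz[OF K] by blast
  obtain B where B: "B > 0" "\<And>x y. gauge_norm L x \<le> gauge_norm L y + B * dist x y"
    using gauge_norm_lipschitz[OF L] by blast
  \<comment> \<open>With this value, moving by \<open>\<kappa> * \<delta>\<close> costs at most the
    available slack \<open>\<delta> / 2\<close>.\<close>
  define \<kappa> where "\<kappa> = 1 / (2 * (B + 2 * r * A))"
  have pos: "B + 2 * r * A > 0" using A B r by (simp add: add_pos_pos)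
  then have \<kappa>: "\<kappa> > 0" "\<kappa> * (B + 2 * r * A) = 1 / 2" by (auto simp: \<kappa>_def)
  define c where "c = \<kappa> ^ DIM('a) * unit_ball_vol (DIM('a))"
  define q where "q = (1 / 2) *\<^sub>R p"
  have q: "gauge_norm K q = 1 / 2" "gauge_norm L q \<le> r / 2"
    using gauge_norm_scale[OF K, of "1/2" p] gauge_norm_scale[OF L, of "1/2" p] p by (auto simp: q_def)
  have "c > 0" using \<kappa> by (simp add: c_def)
  moreover have "c * \<delta> ^ DIM('a) \<le> measure lborel (K \<inter> {x. gauge_norm L x \<le> (r + \<delta>) * gauge_norm K x})"
    if \<delta>: "0 < \<delta>" "\<delta> \<le> r" for \<delta>
  proof -
    have sub: "ball q (\<kappa> * \<delta>) \<subseteq> K \<inter> {x. gauge_norm L x \<le> (r + \<delta>) * gauge_norm K x}"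
    proof
      fix x assume "x \<in> ball q (\<kappa> * \<delta>)"
      then have d: "dist x q \<le> \<kappa> * \<delta>" by (simp add: dist_commute)
      have dA: "A * dist x q \<le> A * (\<kappa> * \<delta>)" and dB: "B * dist x q \<le> B * (\<kappa> * \<delta>)"
        using d A B by (auto intro: mult_left_mono)
      have sum: "B * (\<kappa> * \<delta>) + 2 * r * (A * (\<kappa> * \<delta>)) = \<delta> / 2"
        using arg_cong[OF \<kappa>(2), of "\<lambda>z. z * \<delta>"] by (simp add: algebra_simps)
      have "0 \<le> B * (\<kappa> * \<delta>)" using B \<kappa> \<delta> by simp
      then have "2 * r * (A * (\<kappa> * \<delta>)) \<le> r / 2" using sum \<delta> by linarith
      \<comment> \<open>The gauge of \<open>K\<close> is \<open>1 / 2\<close> at \<open>q\<close>,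
        so the ball stays inside \<open>K\<close>.\<close>
      then have "A * (\<kappa> * \<delta>) \<le> 1 / 4" using r by (simp add: field_simps)
      then have x1: "gauge_norm K x \<le> 1" using A(2)[of x q] dA q by linarith
      have x2: "1 / 2 - A * (\<kappa> * \<delta>) \<le> gauge_norm K x" using A(2)[of q x] dA q by (simp add: dist_commute)
      have "(r + \<delta>) * (1 / 2 - A * (\<kappa> * \<delta>)) \<le> (r + \<delta>) * gauge_norm K x"
        using x2 r \<delta> by (intro mult_left_mono) auto
      moreover have "(r + \<delta>) * (A * (\<kappa> * \<delta>)) \<le> 2 * r * (A * (\<kappa> * \<delta>))"
        using A \<kappa> \<delta> by (intro mult_right_mono) auto
      then have "r / 2 + B * (\<kappa> * \<delta>) \<le> (r + \<delta>) * (1 / 2 - A * (\<kappa> * \<delta>))"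
        using sum by (simp add: right_diff_distrib add_divide_distrib)
      ultimately have "gauge_norm L x \<le> (r + \<delta>) * gauge_norm K x"
        using B(2)[of x q] dB q by linarith
      with x1 show "x \<in> K \<inter> {x. gauge_norm L x \<le> (r + \<delta>) * gauge_norm K x}"
        using gauge_norm_le_iff[OF K, of 1 x] by simp
    qed
    have "c * \<delta> ^ DIM('a) = measure lborel (ball q (\<kappa> * \<delta>))"
      unfolding c_def using content_ball[of "\<kappa> * \<delta>" q] \<kappa> \<delta> by (simp add: power_mult_distrib)
    also have "\<dots> \<le> measure lborel (K \<inter> {x. gauge_norm L x \<le> (r + \<delta>) * gauge_norm K x})"
    proof (rule measure_mono_fmeasurable[OF sub])
      have "compact K" using K by (simp add: convex_body_def)
      moreover have "closed {x. gauge_norm L x \<le> (r + \<delta>) * gauge_norm K x}"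
        using continuous_on_gauge_norm[OF K] continuous_on_gauge_norm[OF L]
        by (intro closed_Collect_le continuous_intros)
      ultimately have "compact (K \<inter> {x. gauge_norm L x \<le> (r + \<delta>) * gauge_norm K x})"
        by (rule compact_Int_closed)
      then show "K \<inter> {x. gauge_norm L x \<le> (r + \<delta>) * gauge_norm K x} \<in> fmeasurable lborel"
        using compact_borel_lborel_finite by (intro fmeasurableI) auto
    qed auto
    finally show ?thesis .
  qed
  ultimately show ?thesis by blast
qed

section \<open>The radial measure as a finite Borel measure\<close>

context
  fixes L :: "'a::euclidean_space set" and \<phi> :: "real \<Rightarrow> real"
  assumes L: "convex_body L" "0 \<in> interior L"
    and nonneg: "\<And>s. 0 \<le> s \<Longrightarrow> 0 \<le> \<phi> s" and mono: "mono_on {0..} \<phi>"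
begin

text \<open>Monotonicity of \<open>\<phi>\<close> is known only on the nonnegative half-line.
  Precomposing with \<open>max 0\<close> gives a function monotone on all reals, hence Borel, and
  changes nothing on gauge values.\<close>

lemma borel_measurable_radial_density [measurable]:
  "(\<lambda>x. exp (- \<phi> (gauge_norm L x))) \<in> borel_measurable borel"
proof -
  have "mono (\<lambda>s. \<phi> (max 0 s))" using mono_onD[OF mono] by (intro monoI) auto
  then have [measurable]: "(\<lambda>s. \<phi> (max 0 s)) \<in> borel_measurable borel" by (rule borel_measurable_mono)
  have [measurable]: "gauge_norm L \<in> borel_measurable borel"
    by (rule borel_measurable_gauge_norm[OF L])
  have "(\<lambda>x. \<phi> (gauge_norm L x)) = (\<lambda>x. \<phi> (max 0 (gauge_norm L x)))"
    using gauge_norm_nonneg[OF L] by (simp add: max_def)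
  also have "\<dots> \<in> borel_measurable borel" by measurable
  finally show ?thesis by measurable
qed

lemma sets_radial_measure: "sets (radial_measure \<phi> L) = sets borel"
  by (simp add: radial_measure_def)

lemma finite_measure_radial_measure:
  assumes "(LINT x|lborel. exp (- \<phi> (gauge_norm L x))) = 1"
  shows "finite_measure (radial_measure \<phi> L)"
proof
  \<comment> \<open>A non-integrable function has integral \<open>0\<close> by default, so the value
    \<open>1\<close> forces integrability.\<close>
  have int: "integrable lborel (\<lambda>x. exp (- \<phi> (gauge_norm L x)))"
    using assms not_integrable_integral_eq by force
  have "emeasure (radial_measure \<phi> L) (space (radial_measure \<phi> L))
      = (\<integral>\<^sup>+ x. ennreal (exp (- \<phi> (gauge_norm L x))) \<partial>lborel)"
    unfolding radial_measure_def by (subst emeasure_density) auto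
  also have "\<dots> = ennreal 1" using nn_integral_eq_integral[OF int] assms by simp
  finally show "emeasure (radial_measure \<phi> L) (space (radial_measure \<phi> L)) \<noteq> \<infinity>" by simp
qed

lemma measure_radial_measure_le:
  assumes fin: "finite_measure (radial_measure \<phi> L)"
    and S: "S \<in> sets borel" "emeasure lborel S < \<infinity>"
    and le: "\<And>x. x \<in> S \<Longrightarrow> a \<le> \<phi> (gauge_norm L x)"
  shows "measure (radial_measure \<phi> L) S \<le> exp (- a) * measure lborel S"
proof -
  interpret finite_measure "radial_measure \<phi> L" by fact
  have "emeasure (radial_measure \<phi> L) S
      = (\<integral>\<^sup>+ x. ennreal (exp (- \<phi> (gauge_norm L x))) * indicator S x \<partial>lborel)"
    unfolding radial_measure_def using S by (subst emeasure_density) auto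
  also have "\<dots> \<le> (\<integral>\<^sup>+ x. ennreal (exp (- a)) * indicator S x \<partial>lborel)"
    using le by (intro nn_integral_mono) (auto simp: indicator_def)
  also have "\<dots> = ennreal (exp (- a)) * emeasure lborel S"
    using S by (simp add: nn_integral_cmult_indicator)
  also have "\<dots> = ennreal (exp (- a) * measure lborel S)"
    using S by (simp add: emeasure_eq_ennreal_measure ennreal_mult less_top)
  finally show ?thesis by (simp add: emeasure_eq_measure)
qed

lemma measure_radial_measure_ge:
  assumes fin: "finite_measure (radial_measure \<phi> L)"
    and S: "S \<in> sets borel" "emeasure lborel S < \<infinity>"
    and ge: "\<And>x. x \<in> S \<Longrightarrow> \<phi> (gauge_norm L x) \<le> a"
  shows "exp (- a) * measure lborel S \<le> measure (radial_measure \<phi> L) S"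
proof -
  interpret finite_measure "radial_measure \<phi> L" by fact
  have "ennreal (exp (- a) * measure lborel S) = ennreal (exp (- a)) * emeasure lborel S"
    using S by (simp add: emeasure_eq_ennreal_measure ennreal_mult less_top)
  also have "\<dots> = (\<integral>\<^sup>+ x. ennreal (exp (- a)) * indicator S x \<partial>lborel)"
    using S by (simp add: nn_integral_cmult_indicator)
  also have "\<dots> \<le> (\<integral>\<^sup>+ x. ennreal (exp (- \<phi> (gauge_norm L x))) * indicator S x \<partial>lborel)"
    using ge by (intro nn_integral_mono) (auto simp: indicator_def)
  also have "\<dots> = emeasure (radial_measure \<phi> L) S"
    unfolding radial_measure_def using S by (subst emeasure_density) auto
  finally show ?thesis by (simp add: emeasure_eq_measure)
qed

context
  fixes K M :: "'a set"
  assumes fin: "finite_measure (radial_measure \<phi> L)"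
    and K: "convex_body K" "0 \<in> interior K" and M: "convex_body M" "0 \<in> interior M"
begin

interpretation finite_measure "radial_measure \<phi> L" by (rule fin)

lemma compact_scale_body: "compact ((*\<^sub>R) s ` K)"
  using K by (auto simp: convex_body_def intro: compact_scaling)

lemma mixed_measure_upper_bound:
  assumes r: "0 < r" "(*\<^sub>R) r ` L \<subseteq> K"
  shows "\<exists>A>0. \<forall>t>0. mixed_measure (radial_measure \<phi> L) ((*\<^sub>R) t ` K) M
    \<le> ereal (A * t ^ (DIM('a) - 1) * exp (- \<phi> (r * t)))"
proof -
  obtain C where C: "C > 0" "M \<subseteq> (*\<^sub>R) C ` K"
    using bounded_imp_subset_scale_body[OF K, of M] M by (auto simp: convex_body_def compact_imp_bounded)
  let ?\<mu> = "radial_measure \<phi> L" and ?n = "DIM('a)" and ?v = "measure lborel K"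
  have cK: "compact K" using K by (simp add: convex_body_def)
  have "mixed_measure ?\<mu> ((*\<^sub>R) t ` K) M \<le> ereal (exp (- \<phi> (r * t)) * ?v * (real ?n * t ^ (?n - 1) * C))"
    if t: "t > 0" for t
  proof -
    let ?R = "\<lambda>e. exp (- \<phi> (r * t)) * ?v * (((t + e * C) ^ ?n - t ^ ?n) / e)"
    have "(measure ?\<mu> ((*\<^sub>R) t ` K + (*\<^sub>R) e ` M) - measure ?\<mu> ((*\<^sub>R) t ` K)) / e \<le> ?R e"
      if e: "e > 0" for e
    proof -
      have ce: "t + e * C > 0" "t \<le> t + e * C" using t e C by (auto simp: add_pos_pos)
      have "measure ?\<mu> ((*\<^sub>R) t ` K + (*\<^sub>R) e ` M) \<le> measure ?\<mu> ((*\<^sub>R) (t + e * C) ` K)"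
        using minkowski_sum_subset_scale[OF K C(2,1) t e] compact_scale_body
        by (intro finite_measure_mono) (auto simp: sets_radial_measure intro: borel_compact)
      then have "measure ?\<mu> ((*\<^sub>R) t ` K + (*\<^sub>R) e ` M) - measure ?\<mu> ((*\<^sub>R) t ` K)
          \<le> measure ?\<mu> ((*\<^sub>R) (t + e * C) ` K - (*\<^sub>R) t ` K)"
        using scale_body_mono[OF K, of t "t + e * C"] t ce compact_scale_body
        by (subst finite_measure_Diff) (auto simp: sets_radial_measure intro: borel_compact)
      also have "\<dots> \<le> exp (- \<phi> (r * t)) * measure lborel ((*\<^sub>R) (t + e * C) ` K - (*\<^sub>R) t ` K)"
      proof (rule measure_radial_measure_le[OF fin])
        show "(*\<^sub>R) (t + e * C) ` K - (*\<^sub>R) t ` K \<in> sets borel"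
          using compact_scale_body by (intro sets.Diff borel_compact)
        have "emeasure lborel ((*\<^sub>R) (t + e * C) ` K - (*\<^sub>R) t ` K) \<le> emeasure lborel ((*\<^sub>R) (t + e * C) ` K)"
          using compact_scale_body by (intro emeasure_mono) (auto intro: borel_compact)
        also have "\<dots> < \<infinity>" using compact_borel_lborel_finite compact_scale_body by blast
        finally show "emeasure lborel ((*\<^sub>R) (t + e * C) ` K - (*\<^sub>R) t ` K) < \<infinity>" .
        fix x assume x: "x \<in> (*\<^sub>R) (t + e * C) ` K - (*\<^sub>R) t ` K"
        \<comment> \<open>Since \<open>r L\<close> lies in \<open>K\<close>, a point outside
          \<open>t K\<close> is outside \<open>t r L\<close>, which bounds the density from
          above.\<close>
        have "x \<notin> (*\<^sub>R) (r * t) ` L"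
        proof
          assume "x \<in> (*\<^sub>R) (r * t) ` L"
          then obtain l where l: "l \<in> L" "x = t *\<^sub>R (r *\<^sub>R l)" by (auto simp: mult.commute)
          then have "r *\<^sub>R l \<in> K" using r by blast
          then show False using x l by blast
        qed
        then have "r * t \<le> gauge_norm L x" using gauge_norm_le_iff[OF L, of "r * t" x] r t by simp
        then show "\<phi> (r * t) \<le> \<phi> (gauge_norm L x)"
          using mono_onD[OF mono, of "r * t" "gauge_norm L x"] gauge_norm_nonneg[OF L] r t by simp
      qed
      also have "\<dots> = exp (- \<phi> (r * t)) * (((t + e * C) ^ ?n - t ^ ?n) * ?v)"
        using scale_body_mono[OF K, of t "t + e * C"] t ce cK
        by (subst measure_lborel_scaled_shell) auto
      finally have "(measure ?\<mu> ((*\<^sub>R) t ` K + (*\<^sub>R) e ` M) - measure ?\<mu> ((*\<^sub>R) t ` K)) / e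
          \<le> exp (- \<phi> (r * t)) * (((t + e * C) ^ ?n - t ^ ?n) * ?v) / e"
        using e by (intro divide_right_mono) auto
      then show ?thesis by (simp add: mult_ac)
    qed
    then have "mixed_measure ?\<mu> ((*\<^sub>R) t ` K) M \<le> Liminf (at_right 0) (\<lambda>e. ereal (?R e))"
      unfolding mixed_measure_eq_Liminf_measure[OF fin]
      by (intro Liminf_mono eventually_mono[OF eventually_at_right_less[of 0]]) simp
    also have "\<dots> = ereal (exp (- \<phi> (r * t)) * ?v * (real ?n * t ^ (?n - 1) * C))"
    proof (rule lim_imp_Liminf)
      \<comment> \<open>The quotient is a difference quotient at \<open>e = 0\<close>, so its limit
        is this derivative.\<close>
      have "((\<lambda>e. (t + e * C) ^ ?n) has_real_derivative (real ?n * t ^ (?n - 1) * C)) (at 0)"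
        by (auto intro!: derivative_eq_intros)
      then have "((\<lambda>e. ((t + e * C) ^ ?n - t ^ ?n) / e) \<longlongrightarrow> real ?n * t ^ (?n - 1) * C) (at_right 0)"
        by (auto simp: has_field_derivative_iff intro: filterlim_at_within_not_equal tendsto_within_subset)
      then show "((\<lambda>e. ereal (?R e)) \<longlongrightarrow> ereal (exp (- \<phi> (r * t)) * ?v * (real ?n * t ^ (?n - 1) * C))) (at_right 0)"
        by (intro tendsto_ereal tendsto_mult tendsto_const)
    qed simp
    finally show ?thesis .
  qed
  \<comment> \<open>Replacing \<open>?v\<close> by \<open>?v + 1\<close> makes the constant positive
    using only that a volume is nonnegative.\<close>
  then have "mixed_measure ?\<mu> ((*\<^sub>R) t ` K) M \<le> ereal (((?v + 1) * real ?n * C) * t ^ (?n - 1) * exp (- \<phi> (r * t)))"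
    if "t > 0" for t
    by (rule order_trans) (use that C in \<open>auto simp: algebra_simps\<close>)
  moreover have "(?v + 1) * real ?n * C > 0" using C by (auto simp: add_nonneg_pos)
  ultimately show ?thesis by blast
qed

text \<open>The width \<open>h\<close> stays free so that it can later depend on \<open>t\<close>. A
  sector of opening proportional to \<open>h / t\<close> has volume at least of order
  \<open>(h / t) ^ n\<close>, and the growth of its dilates contributes
  \<open>n * t ^ (n - 1)\<close>; the product is of order \<open>h ^ n / t\<close>.\<close>

lemma mixed_measure_lower_bound:
  assumes p: "gauge_norm K p = 1" "gauge_norm L p \<le> r" and r: "0 < r"
  shows "\<exists>c>0. \<forall>t\<ge>1. \<forall>h. 0 < h \<and> h \<le> 1 \<longrightarrow>
    ereal (c / t * h ^ DIM('a) * exp (- \<phi> (r * (t + h)))) \<le> mixed_measure (radial_measure \<phi> L) ((*\<^sub>R) t ` K) M"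
proof -
  let ?\<mu> = "radial_measure \<phi> L" and ?n = "DIM('a)"
  obtain D where D: "D > 0" "K \<subseteq> (*\<^sub>R) D ` M"
    using bounded_imp_subset_scale_body[OF M, of K] K by (auto simp: convex_body_def compact_imp_bounded)
  obtain c where c: "c > 0" "\<And>\<delta>. 0 < \<delta> \<Longrightarrow> \<delta> \<le> r \<Longrightarrow>
      c * \<delta> ^ ?n \<le> measure lborel (K \<inter> {x. gauge_norm L x \<le> (r + \<delta>) * gauge_norm K x})"
    using cone_sector_volume_ge[OF K L p r] by blast
  have "ereal ((real ?n * c * (r / 2) ^ ?n / D) / t * h ^ ?n * exp (- \<phi> (r * (t + h))))
      \<le> mixed_measure ?\<mu> ((*\<^sub>R) t ` K) M" if t: "t \<ge> 1" and h: "0 < h" "h \<le> 1" for t h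
  proof -
    \<comment> \<open>Then \<open>(r + \<delta>) * t = r * t + r * h / 2\<close>: the opening uses
      half of the allowance \<open>r * h\<close>, and the enlargement from \<open>t\<close> to
      \<open>s\<close> may use the other half.\<close>
    define \<delta> where "\<delta> = r * h / (2 * t)"
    have \<delta>: "0 < \<delta>" "\<delta> \<le> r"
    proof -
      have "h \<le> 2 * t" using h t by simp
      then show "\<delta> \<le> r" unfolding \<delta>_def using r t by (simp add: divide_le_eq)
    qed (use r h t in \<open>simp add: \<delta>_def\<close>)
    define W where "W = {x. gauge_norm L x \<le> (r + \<delta>) * gauge_norm K x}"
    have cW: "compact (K \<inter> W)"
    proof (rule compact_Int_closed)
      show "closed W" unfolding W_def
        using continuous_on_gauge_norm[OF K] continuous_on_gauge_norm[OF L]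
        by (intro closed_Collect_le continuous_intros)
    qed (use K in \<open>simp add: convex_body_def\<close>)
    \<comment> \<open>Both gauges are positively homogeneous, so \<open>W\<close> is a cone and
      cutting with it commutes with dilation.\<close>
    have W_scale: "s *\<^sub>R x \<in> W \<longleftrightarrow> x \<in> W" if "s > 0" for s x
      using that gauge_norm_scale[OF K, of s x] gauge_norm_scale[OF L, of s x]
      by (simp add: W_def)
    have sector: "(*\<^sub>R) s ` (K \<inter> W) = (*\<^sub>R) s ` K \<inter> W" if "s > 0" for s
      using W_scale[OF that] by auto
    define B where "B = exp (- \<phi> (r * (t + h))) * (c * \<delta> ^ ?n) * (real ?n * t ^ (?n - 1) / D)"
    have lower: "ereal B \<le> ereal ((measure ?\<mu> ((*\<^sub>R) t ` K + (*\<^sub>R) e ` M) - measure ?\<mu> ((*\<^sub>R) t ` K)) / e)"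
      \<comment> \<open>This threshold gives
        \<open>(r + \<delta>) * (e / D) \<le> r * h / 2\<close>, so the sector of \<open>s K\<close>
        has gauge at most \<open>r * (t + h)\<close>.\<close>
      if e: "e > 0" "e < D * (r * h / 2) / (r + \<delta>)" for e
    proof -
      define s where "s = t + e / D"
      have s: "s > 0" "t \<le> s" using t e D by (auto simp: s_def add_pos_pos)
      have sr: "(r + \<delta>) * s \<le> r * (t + h)"
      proof -
        have "e * (r + \<delta>) < D * (r * h / 2)" using e(2) r \<delta>(1) by (simp only: pos_less_divide_eq add_pos_pos)
        then have "(r + \<delta>) * (e / D) \<le> r * h / 2"
          using D(1) by (simp add: pos_divide_le_eq algebra_simps)
        moreover have "(r + \<delta>) * t = r * t + r * h / 2" using t by (simp add: \<delta>_def field_simps)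
        ultimately show ?thesis unfolding s_def distrib_left by linarith
      qed
      let ?S = "(*\<^sub>R) s ` (K \<inter> W) - (*\<^sub>R) t ` (K \<inter> W)"
      have csW: "compact ((*\<^sub>R) u ` (K \<inter> W))" for u using cW by (rule compact_scaling)
      have mono_sW: "(*\<^sub>R) t ` (K \<inter> W) \<subseteq> (*\<^sub>R) s ` (K \<inter> W)"
        using sector[of t] sector[of s] scale_body_mono[OF K, of t s] s t by auto
      \<comment> \<open>Bernoulli's inequality for \<open>s / t = 1 + e / (D * t)\<close>.\<close>
      have "real ?n * t ^ (?n - 1) * (e / D) \<le> s ^ ?n - t ^ ?n"
      proof -
        have "t ^ ?n * (1 + real ?n * (e / (D * t))) \<le> t ^ ?n * (1 + e / (D * t)) ^ ?n"
        proof (intro mult_left_mono)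
          have "0 \<le> e / (D * t)" using e D t by simp
          then have "-1 \<le> e / (D * t)" by linarith
          then show "1 + real ?n * (e / (D * t)) \<le> (1 + e / (D * t)) ^ ?n" by (rule Bernoulli_inequality)
        qed (use t in simp)
        also have "\<dots> = s ^ ?n" using t D by (simp add: s_def field_simps flip: power_mult_distrib)
        finally have "t ^ ?n * (real ?n * (e / (D * t))) \<le> s ^ ?n - t ^ ?n" by (simp add: distrib_left)
        moreover have "t ^ ?n = t ^ (?n - 1) * t" by (rule power_minus_mult[symmetric]) simp
        ultimately show ?thesis using t D by (simp add: field_simps)
      qed
      then have "(c * \<delta> ^ ?n) * (real ?n * t ^ (?n - 1) * (e / D)) \<le> measure lborel (K \<inter> W) * (s ^ ?n - t ^ ?n)"
        using c(2)[OF \<delta>] c(1) \<delta> t e D unfolding W_def[symmetric] by (intro mult_mono) auto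
      from mult_left_mono[OF this, of "exp (- \<phi> (r * (t + h)))"] have "B * e \<le> exp (- \<phi> (r * (t + h))) * ((s ^ ?n - t ^ ?n) * measure lborel (K \<inter> W))"
        unfolding B_def by (simp add: mult_ac)
      also have "\<dots> = exp (- \<phi> (r * (t + h))) * measure lborel ?S"
        using cW s t mono_sW by (subst measure_lborel_scaled_shell) auto
      also have "\<dots> \<le> measure ?\<mu> ?S"
      proof (rule measure_radial_measure_ge[OF fin])
        show "?S \<in> sets borel" using csW by (intro sets.Diff borel_compact)
        have "emeasure lborel ?S \<le> emeasure lborel ((*\<^sub>R) s ` (K \<inter> W))"
          using csW by (intro emeasure_mono) (auto intro: borel_compact)
        also have "\<dots> < \<infinity>" using compact_borel_lborel_finite csW by blast
        finally show "emeasure lborel ?S < \<infinity>" .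
        fix x assume "x \<in> ?S"
        then have x: "x \<in> (*\<^sub>R) s ` K" "x \<in> W" using sector[OF s(1)] by auto
        have "gauge_norm L x \<le> (r + \<delta>) * gauge_norm K x" using x by (simp add: W_def)
        also have "\<dots> \<le> (r + \<delta>) * s" using gauge_norm_le[OF K, of s x] x s r \<delta> by (intro mult_left_mono) auto
        also note sr
        finally show "\<phi> (gauge_norm L x) \<le> \<phi> (r * (t + h))"
          using mono_onD[OF mono, of "gauge_norm L x" "r * (t + h)"] gauge_norm_nonneg[OF L, of x] r t h by simp
      qed
      also have "\<dots> \<le> measure ?\<mu> ((*\<^sub>R) s ` K - (*\<^sub>R) t ` K)"
        using sector[of s] sector[of t] s t compact_scale_body
        by (intro finite_measure_mono sets.Diff) (auto simp: sets_radial_measure intro: borel_compact)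
      also have "\<dots> = measure ?\<mu> ((*\<^sub>R) s ` K) - measure ?\<mu> ((*\<^sub>R) t ` K)"
        using scale_body_mono[OF K, of t s] t s compact_scale_body
        by (intro finite_measure_Diff) (auto simp: sets_radial_measure intro: borel_compact)
      also have "measure ?\<mu> ((*\<^sub>R) s ` K) \<le> measure ?\<mu> ((*\<^sub>R) t ` K + (*\<^sub>R) e ` M)"
        unfolding s_def using scale_subset_minkowski_sum[OF D(2,1), of t e] compact_minkowski_sum_scaled[OF K(1) M(1)]
        by (intro finite_measure_mono) (auto simp: sets_radial_measure intro: borel_compact)
      finally show ?thesis using e by (simp add: field_simps)
    qed
    have "ereal B \<le> mixed_measure ?\<mu> ((*\<^sub>R) t ` K) M"
      unfolding mixed_measure_eq_Liminf_measure[OF fin]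
    proof (intro Liminf_bounded)
      show "\<forall>\<^sub>F e in at_right 0. ereal B \<le>
          ereal ((measure ?\<mu> ((*\<^sub>R) t ` K + (*\<^sub>R) e ` M) - measure ?\<mu> ((*\<^sub>R) t ` K)) / e)"
        unfolding eventually_at_right_field using lower D r h \<delta>
        by (intro exI[of _ "D * (r * h / 2) / (r + \<delta>)"]) auto
    qed
    also have "B = (real ?n * c * (r / 2) ^ ?n / D) / t * h ^ ?n * exp (- \<phi> (r * (t + h)))"
    proof -
      have "t ^ ?n = t ^ (?n - 1) * t" by (rule power_minus_mult[symmetric]) simp
      then show ?thesis using t unfolding B_def \<delta>_def
        by (simp add: field_simps)
    qed
    finally show ?thesis .
  qed
  moreover have "real ?n * c * (r / 2) ^ ?n / D > 0" using c D r by simp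
  ultimately show ?thesis by blast
qed

end

end

section \<open>Logarithmic asymptotics and the exceptional set\<close>

lemma ln_ext_le: "0 < a \<Longrightarrow> x \<le> ereal a \<Longrightarrow> ln_ext x \<le> ereal (ln a)"
  by (cases x) (auto simp: ln_ext_def)

lemma ln_ext_ge: "0 < a \<Longrightarrow> ereal a \<le> x \<Longrightarrow> ereal (ln a) \<le> ln_ext x"
  by (cases x) (auto simp: ln_ext_def)

lemma borel_measurable_ln_ext [measurable]: "ln_ext \<in> borel_measurable borel"
  unfolding ln_ext_def by measurable

text \<open>Ensures that arbitrarily large times avoid an exceptional set of finite measure, as the
  lower bound on the upper limit requires.\<close>

lemma half_line_not_subset_fmeasurable:
  fixes E :: "real set"
  assumes "E \<in> lmeasurable"
  shows "\<not> {T..} \<subseteq> E"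
proof
  assume sub: "{T..} \<subseteq> E"
  have "measure lebesgue {T..T + (measure lebesgue E + 1)} \<le> measure lebesgue E"
    using sub assms by (intro measure_mono_fmeasurable) auto
  then show False by simp
qed

theorem theorem3p4:
  fixes L K M :: "(real ^ 'n) set" and \<phi> :: "real \<Rightarrow> real" and \<mu> :: "(real ^ 'n) measure"
  assumes "CARD('n) \<ge> 2"
    and "convex_body L" and "0 \<in> interior L"
    and "\<And>s. 0 \<le> s \<Longrightarrow> 0 \<le> \<phi> s"
    and "mono_on {0..} \<phi>" and "\<not> \<phi> constant_on {0..}" and "convex_on {0..} \<phi>"
    and "(LINT x|lborel. exp (- \<phi> (gauge_norm L x))) = 1"
    and "\<mu> = radial_measure \<phi> L"
    and "convex_body K" and "convex_body M" and "0 \<in> interior K \<inter> interior M"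
  shows "Limsup at_top (\<lambda>t::real.
           ln_ext (mixed_measure \<mu> ((*\<^sub>R) t ` K) M) / ereal (\<phi> (rel_inradius K L * t))) = -1
    \<and> (\<forall>\<epsilon>>0::real.
         {t::real. 0 < t \<and> 0 < \<phi> (rel_inradius K L * t) \<and>
            \<bar>ln_ext (mixed_measure \<mu> ((*\<^sub>R) t ` K) M) / ereal (\<phi> (rel_inradius K L * t)) + 1\<bar>
              \<ge> ereal \<epsilon>} \<in> lmeasurable)"
proof -
  note L = assms(2,3) and nonneg = assms(4) and mono = assms(5)
  have K: "convex_body K" "0 \<in> interior K" and M: "convex_body M" "0 \<in> interior M"
    using assms by auto
  let ?n = "DIM(real ^ 'n)"
  define r where "r = rel_inradius K L"
  define \<psi> where "\<psi> t = \<phi> (r * t)" for t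
  define f where "f t = mixed_measure \<mu> ((*\<^sub>R) t ` K) M" for t
  define g where "g t = ln_ext (f t) / ereal (\<psi> t)" for t
  obtain p where r: "0 < r" "(*\<^sub>R) r ` L \<subseteq> K" and p: "gauge_norm K p = 1" "gauge_norm L p \<le> r"
    using rel_inradius_contact[OF K L] unfolding r_def by blast
  have fin: "finite_measure \<mu>" "finite_measure (radial_measure \<phi> L)"
    using finite_measure_radial_measure[OF L nonneg mono assms(8)] assms(9) by auto
  have sets: "sets \<mu> = sets borel" using sets_radial_measure[OF L nonneg mono] assms(9) by simp
  obtain A where A: "A > 0" "\<And>t. t > 0 \<Longrightarrow> f t \<le> ereal (A * t ^ (?n - 1) * exp (- \<psi> t))"
    using mixed_measure_upper_bound[OF L nonneg mono fin(2) K M r] assms(9)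
    unfolding f_def \<psi>_def by blast
  obtain c where c: "c > 0" "\<And>t h. 1 \<le> t \<Longrightarrow> 0 < h \<Longrightarrow> h \<le> 1 \<Longrightarrow>
      ereal (c / t * h ^ ?n * exp (- \<psi> (t + h))) \<le> f t"
    using mixed_measure_lower_bound[OF L nonneg mono fin(2) K M p r(1)] assms(9)
    unfolding f_def \<psi>_def by blast
  obtain a b y where ab: "0 < a" "\<And>s. y \<le> s \<Longrightarrow> a * s - b \<le> \<phi> s"
    by (rule convex_mono_linear_lower_bound[OF mono assms(6,7)]) (rule that)
  have \<psi>_nonneg: "0 \<le> \<psi> t" if "0 \<le> t" for t using nonneg r that by (simp add: \<psi>_def)
  have \<psi>_mono: "mono_on {0..} \<psi>"
    unfolding \<psi>_def using r by (intro mono_onI mono_onD[OF mono]) (auto intro: mult_left_mono)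
  \<comment> \<open>At least linear growth of \<open>\<phi>\<close> lets any fraction
    \<open>\<eta>\<close> of \<open>\<psi>\<close> absorb the constants and powers of
    \<open>t\<close> in the two bounds.\<close>
  have growth: "eventually (\<lambda>t. C + k * ln t < \<eta> * \<psi> t) at_top" if \<eta>: "\<eta> > 0" for C k \<eta>
  proof -
    have "0 < \<eta> * a * r" using \<eta> ab r by simp
    moreover have "((\<lambda>t. (C + \<eta> * b) * inverse t + k * (ln t / t)) \<longlongrightarrow> (C + \<eta> * b) * 0 + k * 0) at_top"
      by (intro tendsto_intros tendsto_inverse_0_at_top filterlim_ident ln_x_over_x_tendsto_0)
    ultimately have "eventually (\<lambda>t. (C + \<eta> * b) * inverse t + k * (ln t / t) < \<eta> * a * r) at_top"
      by (intro order_tendstoD(2)) auto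
    then have "eventually (\<lambda>t. C + \<eta> * b + k * ln t < (\<eta> * a * r) * t) at_top"
      using eventually_gt_at_top[of 0] by eventually_elim (simp add: field_simps)
    moreover have "eventually (\<lambda>t. y / r \<le> t) at_top" by (rule eventually_ge_at_top)
    ultimately show ?thesis
    proof eventually_elim
      case (elim t)
      then have "a * (r * t) - b \<le> \<psi> t" unfolding \<psi>_def using r by (intro ab) (simp add: field_simps)
      then have "\<eta> * (a * (r * t) - b) \<le> \<eta> * \<psi> t" using \<eta> by simp
      with elim show ?case by (simp add: algebra_simps)
    qed
  qed
  have \<psi>_pos: "eventually (\<lambda>t. 0 < \<psi> t) at_top" using growth[of 1 0 0] by simp
  have upper: "eventually (\<lambda>t. g t < ereal (-1 + \<epsilon>)) at_top" if "\<epsilon> > 0" for \<epsilon>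
    using growth[OF that, of "ln A" "real (?n - 1)"] \<psi>_pos eventually_gt_at_top[of 0]
  proof eventually_elim
    case (elim t)
    have "ln_ext (f t) \<le> ereal (ln (A * t ^ (?n - 1) * exp (- \<psi> t)))"
      using A elim by (intro ln_ext_le) auto
    also have "ln (A * t ^ (?n - 1) * exp (- \<psi> t)) = ln A + real (?n - 1) * ln t - \<psi> t"
      using A elim by (simp add: ln_mult ln_realpow)
    finally have "g t \<le> ereal (ln A + real (?n - 1) * ln t - \<psi> t) / ereal (\<psi> t)"
      unfolding g_def using elim by (intro ereal_divide_right_mono) auto
    also have "\<dots> = ereal ((ln A + real (?n - 1) * ln t - \<psi> t) / \<psi> t)" using elim by simp
    finally have "g t \<le> ereal ((ln A + real (?n - 1) * ln t - \<psi> t) / \<psi> t)" .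
    moreover have "(ln A + real (?n - 1) * ln t - \<psi> t) / \<psi> t < -1 + \<epsilon>"
      unfolding pos_divide_less_eq[OF elim(2)] distrib_right using elim(1) by linarith
    ultimately show ?case by (meson le_less_trans less_ereal.simps(1))
  qed
  have lower: "\<exists>E\<in>lmeasurable. eventually (\<lambda>t. t \<notin> E \<longrightarrow> ereal (-1 - \<epsilon>) < g t) at_top"
    if \<epsilon>: "\<epsilon> > 0" for \<epsilon>
  proof -
    \<comment> \<open>With \<open>h = exp (- d * \<psi> t)\<close>, the factor \<open>h ^ n\<close>
      costs \<open>\<epsilon> / 2 * \<psi> t\<close> in the logarithm. The remaining
      \<open>\<epsilon> / 2\<close> absorbs \<open>ln t\<close>, \<open>ln c\<close> and the rise of
      \<open>\<psi>\<close> by at most \<open>1\<close> outside \<open>E\<close>.\<close>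
    define d where "d = \<epsilon> / (2 * real ?n)"
    have d: "d > 0" "real ?n * d = \<epsilon> / 2" using \<epsilon> by (auto simp: d_def)
    obtain E where E: "E \<in> lmeasurable"
      "\<And>t. 0 \<le> t \<Longrightarrow> t \<notin> E \<Longrightarrow> \<psi> (t + exp (- d * \<psi> t)) \<le> \<psi> t + 1"
      using slow_growth_outside_finite_measure[OF \<psi>_nonneg \<psi>_mono d(1)] by blast
    have "\<epsilon> / 2 > 0" using \<epsilon> by simp
    have "eventually (\<lambda>t. t \<notin> E \<longrightarrow> ereal (-1 - \<epsilon>) < g t) at_top"
      using growth[OF \<open>\<epsilon> / 2 > 0\<close>, of "1 - ln c" 1] \<psi>_pos eventually_ge_at_top[of 1]
    proof eventually_elim
      case (elim t)
      show ?case
      proof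
        assume t: "t \<notin> E"
        define h where "h = exp (- d * \<psi> t)"
        have h: "0 < h" "h \<le> 1" using d elim by (auto simp: h_def)
        have \<psi>h: "\<psi> (t + h) \<le> \<psi> t + 1" using E(2)[OF _ t] elim by (simp add: h_def)
        have "ln (c / t * h ^ ?n * exp (- \<psi> (t + h))) = ln c - ln t + real ?n * ln h - \<psi> (t + h)"
          using c elim h by (simp add: ln_mult ln_div ln_realpow)
        also have "real ?n * ln h = - (\<epsilon> / 2 * \<psi> t)"
          using arg_cong[OF d(2), of "\<lambda>z. z * \<psi> t"] by (simp add: h_def)
        finally have "ln (c / t * h ^ ?n * exp (- \<psi> (t + h))) = ln c - ln t - \<epsilon> / 2 * \<psi> t - \<psi> (t + h)"
          by simp
        moreover have "ereal (ln (c / t * h ^ ?n * exp (- \<psi> (t + h)))) \<le> ln_ext (f t)"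
          using c(2)[of t h] c(1) elim h by (intro ln_ext_ge) auto
        ultimately have "ereal ((ln c - ln t - \<epsilon> / 2 * \<psi> t - \<psi> (t + h)) / \<psi> t) \<le> g t"
          unfolding g_def using elim
          ereal_divide_right_mono[of "ereal (ln c - ln t - \<epsilon> / 2 * \<psi> t - \<psi> (t + h))" "ln_ext (f t)" "ereal (\<psi> t)"]
          by simp
        moreover have "-1 - \<epsilon> < (ln c - ln t - \<epsilon> / 2 * \<psi> t - \<psi> (t + h)) / \<psi> t"
        proof -
          have "(-1 - \<epsilon>) * \<psi> t = - \<psi> t - \<epsilon> / 2 * \<psi> t - \<epsilon> / 2 * \<psi> t" by (simp add: algebra_simps)
          also have "\<dots> < ln c - ln t - \<epsilon> / 2 * \<psi> t - \<psi> (t + h)" using elim(1) \<psi>h by simp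
          finally show ?thesis using elim by (simp add: pos_less_divide_eq)
        qed
        ultimately show "ereal (-1 - \<epsilon>) < g t" by (meson less_ereal.simps(1) less_le_trans)
      qed
    qed
    with E(1) show ?thesis by blast
  qed
  have "Limsup at_top g = -1"
  proof (rule antisym)
    show "Limsup at_top g \<le> -1"
    proof (rule ereal_le_epsilon2)
      fix e :: real assume "e > 0"
      then have "Limsup at_top g \<le> ereal (-1 + e)"
        by (intro Limsup_bounded eventually_mono[OF upper]) auto
      then show "Limsup at_top g \<le> -1 + ereal e" by (simp add: one_ereal_def)
    qed
    show "-1 \<le> Limsup at_top g"
    proof (rule ccontr)
      assume "\<not> -1 \<le> Limsup at_top g"
      then obtain z where z: "Limsup at_top g < ereal z" "ereal z < -1"
        using ereal_dense2 by (meson not_le)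
      have "z < -1" using z(2) by (simp add: one_ereal_def)
      \<comment> \<open>With tolerance \<open>-1 - z\<close> the lower bound outside
        \<open>E\<close> is exactly \<open>z\<close>, while eventually \<open>g t < z\<close>; hence
        \<open>E\<close> would contain a half-line.\<close>
      then obtain E where E: "E \<in> lmeasurable" "eventually (\<lambda>t. t \<notin> E \<longrightarrow> ereal (-1 - (-1 - z)) < g t) at_top"
        using lower[of "-1 - z"] by auto
      have "eventually (\<lambda>t. g t < ereal z) at_top" using z(1) by (rule Limsup_lessD)
      with E(2) have "eventually (\<lambda>t. t \<in> E) at_top" by eventually_elim auto
      then obtain T where "{T..} \<subseteq> E" by (auto simp: eventually_at_top_linorder)
      then show False using half_line_not_subset_fmeasurable[OF E(1)] by blast
    qed
  qed
  moreover have "{t. 0 < t \<and> 0 < \<psi> t \<and> ereal \<epsilon> \<le> \<bar>g t + 1\<bar>} \<in> lmeasurable" (is "?S \<in> _")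
    if \<epsilon>: "\<epsilon> > 0" for \<epsilon>
  proof -
    obtain E where E: "E \<in> lmeasurable" "eventually (\<lambda>t. t \<notin> E \<longrightarrow> ereal (-1 - \<epsilon>) < g t) at_top"
      using lower[OF \<epsilon>] by blast
    have "eventually (\<lambda>t. t \<in> E \<or> \<not> ereal \<epsilon> \<le> \<bar>g t + 1\<bar>) at_top"
      using E(2) upper[OF \<epsilon>]
    proof eventually_elim
      case (elim t)
      then show ?case by (cases "g t") (auto simp: one_ereal_def)
    qed
    then obtain T where T: "\<And>t. T \<le> t \<Longrightarrow> t \<in> E \<or> \<not> ereal \<epsilon> \<le> \<bar>g t + 1\<bar>"
      by (auto simp: eventually_at_top_linorder)
    \<comment> \<open>Beyond \<open>T\<close> both estimates hold off \<open>E\<close>, so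
      deviations occur only in a bounded interval or in \<open>E\<close>.\<close>
    have sub: "?S \<subseteq> {0..T} \<union> E"
    proof
      fix t assume "t \<in> ?S"
      then show "t \<in> {0..T} \<union> E" using T[of t] by (cases "T \<le> t") auto
    qed
    \<comment> \<open>Measurability of \<open>f\<close> and \<open>\<psi>\<close> is available for
      positive times only, and the set lies there by definition.\<close>
    let ?R = "restrict_space borel {0<..} :: real measure"
    have [measurable]: "f \<in> borel_measurable ?R"
      unfolding f_def using borel_measurable_mixed_measure_scale[OF fin(1) sets K M] by simp
    have [measurable]: "\<psi> \<in> borel_measurable ?R"
      using \<psi>_mono by (intro borel_measurable_mono_on_fnc) (auto intro: mono_on_subset)
    have "{t \<in> space ?R. 0 < \<psi> t \<and> ereal \<epsilon> \<le> \<bar>g t + 1\<bar>} \<in> sets ?R"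
      unfolding g_def by measurable
    then have "?S \<in> sets borel"
      by (simp add: sets_restrict_space_iff space_restrict_space)
    then show ?thesis using E(1) by (intro fmeasurableI2[OF _ sub] fmeasurable.Un) auto
  qed
  ultimately show ?thesis by (simp add: g_def[abs_def] f_def \<psi>_def r_def)
qed

end
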